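(* Let $f:\mathbf{R}^N\to\mathbf{R}$, $f(x)=\sum_{j=1}^m f_j(x)$, where each $f_j:\mathbf{R}^N\to\mathbf{R}$ is convex and differentiable and depends only on the blocks $x^{(i)}$ with $i\in C_j\subseteq[n]$. Put $\omega_j=|C_j|$. Assume there are constants $L_{ji}\ge 0$ ($j=1,\dots,m$, $i=1,\dots,n$), with $L_{ji}=0$ whenever $i\notin C_j$, such that for all $j$ and $i$ $$\|\nabla_i f_j(x+U_it)-\nabla_i f_j(x)\|_{(i)}^*\le L_{ji}\|t\|_{(i)},\qquad x\in\mathbf{R}^N,\ t\in\mathbf{R}^{N_i}.$$ (i) Let $\tau\in\{1,\dots,n\}$ and let $\hat S$ be a $\tau$-nice sampling. Then for all $x,h\in\mathbf{R}^N$, $$\mathbf{E}\left[f(x+h_{[\hat S]})\right]\le f(x)+\frac{\tau}{n}\left(\langle\nabla f(x),h\rangle+\frac12\|h\|_v^2\right),$$ where $$v_i=\sum_{j=1}^m\beta_jL_{ji}=\sum_{j:\,i\in C_j}\beta_jL_{ji},\quad i=1,\dots,n,\qquad \beta_j=1+\frac{(\omega_j-1)(\tau-1)}{\max\{1,n-1\}},\quad j=1,\dots,m.$$ (ii) Moreover, for all $x,h\in\mathbf{R}^N$, $$f(x+h)\le f(x)+\langle\nabla f(x),h\rangle+\frac{\bar\omega\bar L}{2}\|h\|_w^2,$$ where (assuming $\sum_{k,l}L_{kl}>0$, so that the quantities are defined) $$\bar\omega=\sum_{j}\omega_j\frac{\sum_{i}L_{ji}}{\sum_{k,i}L_{ki}},\qquad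 \bar L=\frac{\sum_{j,i}L_{ji}}{n},\qquad w_i=\frac{n}{\sum_{j,l}\omega_jL_{jl}}\sum_j\omega_jL_{ji}.$$
   Context: Blocks: $N=N_1+\dots+N_n$, $[n]=\{1,\dots,n\}$; the $N\times N$ identity matrix is split into column submatrices $U=[U_1,\dots,U_n]$ with $U_i\in\mathbf{R}^{N\times N_i}$. For $x\in\mathbf{R}^N$, $x^{(i)}=U_i^Tx\in\mathbf{R}^{N_i}$, so $x=\sum_iU_ix^{(i)}$. For $S\subseteq[n]$, $h_{[S]}=\sum_{i\in S}U_ih^{(i)}$. For differentiable $g$, $\nabla_ig(x)=U_i^T\nabla g(x)$. Norms: for each $i$ a symmetric positive definite matrix $B_i\in\mathbf{R}^{N_i\times N_i}$ is fixed; $\|t\|_{(i)}=\langle B_it,t\rangle^{1/2}$ and $\|t\|_{(i)}^*=\langle B_i^{-1}t,t\rangle^{1/2}$ for $t\in\mathbf{R}^{N_i}$. For weights $v=(v_1,\dots,v_n)$ with nonnegative entries, $\|x\|_v^2=\sum_{i=1}^nv_i\|x^{(i)}\|_{(i)}^2$. A $\tau$-nice sampling is a random subset $\hat S$ of $[n]$ of cardinality $\tau$, chosen uniformly at random among all subsets of $[n]$ of cardinality $\tau$. $\langle\cdot,\cdot\rangle$ is the standard inner product. *)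

theory Defs
  imports "HOL-Probability.Probability"
begin

text \<open>
  The coordinates of \<open>R^N\<close> are indexed by a finite type \<open>'k\<close>, so \<open>N = CARD('k)\<close>. The splitting of
  the coordinates into blocks is a map \<open>blk\<close> sending a coordinate to the number of its block, so
  \<open>N_i = card {k. blk k = i}\<close>. As the \<open>N_i\<close> vary with \<open>i\<close>, vectors of \<open>R^(N_i)\<close> and matrices of
  format \<open>N_i * N_i\<close> and \<open>N * N_i\<close> are padded with zeros: \<open>R^(N_i)\<close> is the set of vectors in \<open>R^N\<close>
  supported on block \<open>i\<close>.
\<close>

definition block_space :: "('k::finite \<Rightarrow> nat) \<Rightarrow> nat \<Rightarrow> (real ^ 'k) set" where
  "block_space blk i = {t. \<forall>k. blk k \<noteq> i \<longrightarrow> t $ k = 0}"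

definition block_matrices :: "('k::finite \<Rightarrow> nat) \<Rightarrow> nat \<Rightarrow> (real ^ 'k ^ 'k) set" where
  "block_matrices blk i = {A. \<forall>k l. blk k \<noteq> i \<or> blk l \<noteq> i \<longrightarrow> A $ k $ l = 0}"

text \<open>
  The column submatrix \<open>U_i\<close> of the identity. With the padding it is at the same time the identity
  matrix of format \<open>N_i * N_i\<close>.
\<close>

definition block_U :: "('k::finite \<Rightarrow> nat) \<Rightarrow> nat \<Rightarrow> real ^ 'k ^ 'k" where
  "block_U blk i = (\<chi> k l. if k = l \<and> blk l = i then 1 else 0)"

definition block :: "('k::finite \<Rightarrow> nat) \<Rightarrow> nat \<Rightarrow> real ^ 'k \<Rightarrow> real ^ 'k" where
  "block blk i x = transpose (block_U blk i) *v x"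

definition restrict_blocks :: "('k::finite \<Rightarrow> nat) \<Rightarrow> nat set \<Rightarrow> real ^ 'k \<Rightarrow> real ^ 'k" where
  "restrict_blocks blk S h = (\<Sum>i\<in>S. block_U blk i *v block blk i h)"

definition gradient :: "('a::real_inner \<Rightarrow> real) \<Rightarrow> 'a \<Rightarrow> 'a" where
  "gradient g x = (THE d. GDERIV g x :> d)"

definition block_gradient ::
    "('k::finite \<Rightarrow> nat) \<Rightarrow> nat \<Rightarrow> (real ^ 'k \<Rightarrow> real) \<Rightarrow> real ^ 'k \<Rightarrow> real ^ 'k" where
  "block_gradient blk i g x = transpose (block_U blk i) *v gradient g x"

definition block_spd :: "('k::finite \<Rightarrow> nat) \<Rightarrow> nat \<Rightarrow> real ^ 'k ^ 'k \<Rightarrow> bool" where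
  "block_spd blk i A \<longleftrightarrow> A \<in> block_matrices blk i \<and> transpose A = A \<and>
     (\<forall>t\<in>block_space blk i. t \<noteq> 0 \<longrightarrow> (A *v t) \<bullet> t > 0)"

text \<open>The inverse within the matrices of format \<open>N_i * N_i\<close>; the padded matrix itself is singular.\<close>

definition block_inv :: "('k::finite \<Rightarrow> nat) \<Rightarrow> nat \<Rightarrow> real ^ 'k ^ 'k \<Rightarrow> real ^ 'k ^ 'k" where
  "block_inv blk i A =
     (THE A'. A' \<in> block_matrices blk i \<and> A ** A' = block_U blk i \<and> A' ** A = block_U blk i)"

text \<open>The block norms only depend on the matrix \<open>B_i\<close>, which is passed as \<open>A\<close>.\<close>

definition block_norm :: "real ^ 'k ^ 'k \<Rightarrow> real ^ 'k::finite \<Rightarrow> real" where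
  "block_norm A t = sqrt ((A *v t) \<bullet> t)"

definition block_dual_norm ::
    "('k::finite \<Rightarrow> nat) \<Rightarrow> nat \<Rightarrow> real ^ 'k ^ 'k \<Rightarrow> real ^ 'k \<Rightarrow> real" where
  "block_dual_norm blk i A t = sqrt ((block_inv blk i A *v t) \<bullet> t)"

definition weighted_norm ::
    "('k::finite \<Rightarrow> nat) \<Rightarrow> nat \<Rightarrow> (nat \<Rightarrow> real ^ 'k ^ 'k) \<Rightarrow> (nat \<Rightarrow> real) \<Rightarrow> real ^ 'k \<Rightarrow> real" where
  "weighted_norm blk n B v x = sqrt (\<Sum>i=1..n. v i * (block_norm (B i) (block blk i x))\<^sup>2)"

text \<open>The law of a \<open>\<tau>\<close>-nice sampling.\<close>

definition nice_sampling :: "nat \<Rightarrow> nat \<Rightarrow> nat set pmf" where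
  "nice_sampling n \<tau> = pmf_of_set {S. S \<subseteq> {1..n} \<and> card S = \<tau>}"

end

theory Submission
  imports Defs
begin

text \<open>
  Fix \<open>j\<close>, let \<open>S\<close> be a set of blocks and \<open>k = |S \<inter> C_j|\<close>. As \<open>f_j\<close> only sees the blocks in \<open>C_j\<close>,
  \<open>f_j (x + h_[S])\<close> is the value of \<open>f_j\<close> at the average of the \<open>k\<close> points \<open>x + k U_i h^(i)\<close>,
  \<open>i \<in> S \<inter> C_j\<close>. Convexity and the descent inequality along a single block bound it by
  \<open>f_j x + (\<Sum>i\<in>S \<inter> C_j. \<langle>\<nabla>_i f_j x, h^(i)\<rangle> + k / 2 * L_ji * \<parallel>h^(i)\<parallel>^2)\<close>. For \<open>S = [n]\<close> summing over \<open>j\<close>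
  yields (ii). For (i) take expectations: a \<open>\<tau>\<close>-nice sampling contains a given block with probability
  \<open>\<tau> / n\<close> and two given blocks with probability \<open>\<tau> (\<tau> - 1) / (n (n - 1))\<close>, so the factor \<open>k\<close>, which
  counts the members of \<open>S \<inter> C_j\<close>, turns into \<open>\<beta>_j\<close>.
\<close>

section \<open>Blocks and their norms\<close>

lemma block_nth: "block blk i x $ k = (if blk k = i then x $ k else 0)"
  by (simp add: block_def block_U_def matrix_vector_mult_def transpose_def if_distrib[of "\<lambda>c. c * _"]
      sum.delta cong: if_cong conj_cong)

lemma transpose_block_U [simp]: "transpose (block_U blk i) = block_U blk i"
  by (auto simp: vec_eq_iff transpose_def block_U_def)

lemma block_U_mult_vec: "block_U blk i *v x = block blk i x"
  by (simp add: block_def)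

lemma block_in_block_space [simp]: "block blk i x \<in> block_space blk i"
  by (simp add: block_space_def block_nth)

lemma block_eq_self: "t \<in> block_space blk i \<Longrightarrow> block blk i t = t"
  by (auto simp: block_space_def block_nth vec_eq_iff)

lemma block_space_scaleR: "t \<in> block_space blk i \<Longrightarrow> c *\<^sub>R t \<in> block_space blk i"
  by (simp add: block_space_def)

lemma block_diff: "block blk i (x - y) = block blk i x - block blk i y"
  by (simp add: vec_eq_iff block_nth)

text \<open>Taking a block is an orthogonal projection, hence self-adjoint. A direction inside block
  \<open>i\<close> therefore only sees that block of a gradient.\<close>

lemma inner_block: "block blk i x \<bullet> y = x \<bullet> block blk i y"
  by (auto simp: inner_vec_def block_nth intro!: sum.cong)

lemma restrict_blocks_eq_sum: "restrict_blocks blk S h = (\<Sum>i\<in>S. block blk i h)"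
  by (simp add: restrict_blocks_def block_U_mult_vec block_eq_self)

lemma restrict_blocks_nth:
  assumes "finite S"
  shows "restrict_blocks blk S h $ k = (if blk k \<in> S then h $ k else 0)"
  using assms by (simp add: restrict_blocks_eq_sum block_nth)

lemma restrict_blocks_all:
  assumes "\<And>k. blk k \<in> S" "finite S"
  shows "restrict_blocks blk S h = h"
  using assms by (simp add: vec_eq_iff restrict_blocks_nth)

section \<open>Padded matrices and the inverse on a block\<close>

lemma block_U_matrix_mult: "(block_U blk i ** A) $ k $ l = (if blk k = i then A $ k $ l else 0)"
proof -
  have "(block_U blk i ** A) $ k $ l = (block_U blk i *v column l A) $ k"
    by (simp add: matrix_matrix_mult_def matrix_vector_mult_def column_def)
  then show ?thesis
    by (simp add: block_U_mult_vec block_nth column_def)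
qed

lemma matrix_mult_block_U: "(A ** block_U blk i) $ k $ l = (if blk l = i then A $ k $ l else 0)"
proof -
  have "A ** block_U blk i = transpose (block_U blk i ** transpose A)"
    by (simp add: matrix_transpose_mul)
  then show ?thesis
    by (simp add: transpose_def block_U_matrix_mult)
qed

text \<open>Multiplying by \<open>block_U\<close> from the left or right clears the rows or columns
  outside the block. In this form the support condition says that \<open>block_U\<close> acts as a
  unit, and the inverse can be handled by associativity alone.\<close>

lemma block_matrices_iff:
  "A \<in> block_matrices blk i \<longleftrightarrow> block_U blk i ** A = A \<and> A ** block_U blk i = A"
  unfolding block_matrices_def vec_eq_iff block_U_matrix_mult matrix_mult_block_U mem_Collect_eq
  by (metis (full_types))

lemma block_U_idem: "block_U blk i ** block_U blk i = block_U blk i"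
  by (auto simp: vec_eq_iff block_U_matrix_mult) (auto simp: block_U_def)

text \<open>The padded matrix \<open>A\<close> becomes invertible once the identity is put on the other blocks.\<close>

lemma block_inv_exists:
  assumes "block_spd blk i A"
  shows "\<exists>A'. A' \<in> block_matrices blk i \<and> A ** A' = block_U blk i \<and> A' ** A = block_U blk i"
proof -
  let ?U = "block_U blk i"
  define M where "M = A + (mat 1 - ?U)"
  have A: "?U ** A = A" "A ** ?U = A"
    using assms by (auto simp: block_spd_def block_matrices_iff)
  have UM: "?U ** M = A" and MU: "M ** ?U = A"
    using assms unfolding vec_eq_iff block_U_matrix_mult matrix_mult_block_U
    by (auto simp: M_def block_U_def mat_def block_spd_def block_matrices_def)
  \<comment> \<open>\<open>M\<close> has trivial kernel: projecting \<open>M *v x = 0\<close> onto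
    the block gives \<open>A *v x = 0\<close>, what remains says that \<open>x\<close> lies in the
    block, and there \<open>A\<close> is positive definite.\<close>
  have "x = 0" if "M *v x = 0" for x
  proof -
    have Mx: "A *v x + (x - block blk i x) = 0"
      using that by (simp add: M_def matrix_vector_mult_add_rdistrib matrix_vector_mult_diff_rdistrib
          block_U_mult_vec)
    have Ax: "A *v x = ?U *v (M *v x)"
      by (simp add: matrix_vector_mul_assoc UM)
    then have "A *v x = 0"
      by (simp add: that)
    moreover from this Mx have "block blk i x = x"
      by simp
    then have "x \<in> block_space blk i"
      by (metis block_in_block_space)
    ultimately show "x = 0"
      using assms by (auto simp: block_spd_def)
  qed
  then obtain M' where M': "M' ** M = mat 1"
    using matrix_left_invertible_ker by blast
  then have M'2: "M ** M' = mat 1"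
    by (simp add: matrix_left_right_inverse)
  \<comment> \<open>\<open>M\<close> commutes with \<open>?U\<close>, as both products equal
    \<open>A\<close>; hence so does its inverse. Cutting \<open>M'\<close> down to the block then
    gives the inverse of \<open>A\<close>.\<close>
  have comm: "?U ** M' = M' ** ?U"
    by (metis M' M'2 UM MU matrix_mul_assoc matrix_mul_lid matrix_mul_rid)
  have "M' ** ?U \<in> block_matrices blk i"
    by (metis block_matrices_iff block_U_idem comm matrix_mul_assoc)
  moreover have "A ** (M' ** ?U) = ?U"
    by (metis comm UM M'2 block_U_idem matrix_mul_assoc matrix_mul_rid)
  moreover have "(M' ** ?U) ** A = ?U"
    by (metis A(1) MU M' matrix_mul_assoc matrix_mul_lid)
  ultimately show ?thesis
    by blast
qed

text \<open>This makes the definite description in \<open>block_inv\<close> meaningful. Uniqueness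
  is the usual comparison of a left with a right inverse, with \<open>block_U\<close> in the role of
  the unit.\<close>

lemma block_inv:
  assumes "block_spd blk i A"
  shows "block_inv blk i A \<in> block_matrices blk i" "A ** block_inv blk i A = block_U blk i"
    "block_inv blk i A ** A = block_U blk i"
proof -
  have "\<exists>!A'. A' \<in> block_matrices blk i \<and> A ** A' = block_U blk i \<and> A' ** A = block_U blk i"
  proof (rule ex_ex1I[OF block_inv_exists[OF assms]])
    fix P Q
    assume P: "P \<in> block_matrices blk i \<and> A ** P = block_U blk i \<and> P ** A = block_U blk i"
      and Q: "Q \<in> block_matrices blk i \<and> A ** Q = block_U blk i \<and> Q ** A = block_U blk i"
    have "P = P ** (A ** Q)"
      using P Q by (simp add: block_matrices_iff)
    also have "\<dots> = (P ** A) ** Q"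
      by (rule matrix_mul_assoc)
    also have "\<dots> = Q"
      using P Q by (simp add: block_matrices_iff)
    finally show "P = Q" .
  qed
  from theI'[OF this] show "block_inv blk i A \<in> block_matrices blk i"
    "A ** block_inv blk i A = block_U blk i" "block_inv blk i A ** A = block_U blk i"
    unfolding block_inv_def by auto
qed

section \<open>Block norms and their duality\<close>

lemma block_spd_nonneg:
  assumes "block_spd blk i A" "t \<in> block_space blk i"
  shows "(A *v t) \<bullet> t \<ge> 0"
  using assms by (cases "t = 0") (auto simp: block_spd_def less_imp_le)

lemma block_spd_symmetric:
  assumes "block_spd blk i A"
  shows "(A *v s) \<bullet> t = s \<bullet> (A *v t)"
  using assms by (metis block_spd_def dot_lmul_matrix vector_transpose_matrix)

lemma block_norm_scaleR: "c \<ge> 0 \<Longrightarrow> block_norm A (c *\<^sub>R t) = c * block_norm A t"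
  by (simp add: block_norm_def matrix_vector_mult_scaleR real_sqrt_mult flip: mult.assoc)

lemma block_norm_power2:
  assumes "block_spd blk i A" "t \<in> block_space blk i"
  shows "(block_norm A t)\<^sup>2 = (A *v t) \<bullet> t"
  using block_spd_nonneg[OF assms] by (simp add: block_norm_def)

text \<open>Discriminant argument: the form at \<open>r *\<^sub>R s + t\<close> is a nonnegative
  quadratic in \<open>r\<close>.\<close>

lemma Cauchy_Schwarz_block_spd:
  assumes A: "block_spd blk i A" and s: "s \<in> block_space blk i" and t: "t \<in> block_space blk i"
  shows "(A *v s) \<bullet> t \<le> block_norm A s * block_norm A t"
proof -
  define a b c where "a = (A *v s) \<bullet> s" and "b = (A *v s) \<bullet> t" and "c = (A *v t) \<bullet> t"
  have quad: "0 \<le> a * r\<^sup>2 + 2 * b * r + c" for r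
  proof -
    have "r *\<^sub>R s + t \<in> block_space blk i"
      using s t by (simp add: block_space_def)
    from block_spd_nonneg[OF A this] show ?thesis
      using block_spd_symmetric[OF A, of t s]
      by (simp add: a_def b_def c_def matrix_vector_mult_scaleR matrix_vector_right_distrib
          inner_add_left inner_add_right power2_eq_square inner_commute algebra_simps)
  qed
  have a: "a \<ge> 0" and c: "c \<ge> 0"
    using block_spd_nonneg[OF A] s t by (auto simp: a_def c_def)
  have "b\<^sup>2 \<le> a * c"
  proof (cases "s = 0")
    case True
    then show ?thesis by (simp add: a_def b_def)
  next
    case False
    then have "a > 0"
      using A s by (auto simp: a_def block_spd_def)
    \<comment> \<open>The minimiser of the quadratic; it exists because \<open>s \<noteq> 0\<close>
      makes the leading coefficient positive.\<close>
    with quad[of "- b / a"] show ?thesis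
      by (simp add: field_simps power2_eq_square)
  qed
  then have "b \<le> sqrt (a * c)"
    by (rule real_le_rsqrt)
  then show ?thesis
    by (simp add: block_norm_def a_def b_def c_def real_sqrt_mult)
qed

text \<open>With \<open>s\<close> the image of \<open>u\<close> under the block inverse,
  \<open>u = A *v s\<close> and the dual norm of \<open>u\<close> is the primal norm of
  \<open>s\<close>, so the claim is Cauchy-Schwarz for the form of \<open>A\<close>.\<close>

lemma inner_le_block_dual_norm:
  assumes A: "block_spd blk i A" and u: "u \<in> block_space blk i" and t: "t \<in> block_space blk i"
  shows "u \<bullet> t \<le> block_dual_norm blk i A u * block_norm A t"
proof -
  define s where "s = block_inv blk i A *v u"
  have "s = block blk i s"
    using block_inv(1)[OF A]
    by (simp add: s_def block_matrices_iff matrix_vector_mul_assoc flip: block_U_mult_vec)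
  then have s: "s \<in> block_space blk i"
    by (metis block_in_block_space)
  have As: "A *v s = u"
    by (simp add: s_def matrix_vector_mul_assoc block_inv(2)[OF A] block_U_mult_vec
        block_eq_self[OF u])
  then have "block_dual_norm blk i A u = block_norm A s"
    by (simp add: block_dual_norm_def block_norm_def s_def inner_commute)
  with Cauchy_Schwarz_block_spd[OF A s t] As show ?thesis
    by simp
qed

section \<open>Descent along blocks\<close>

lemma gradient_eq:
  assumes "GDERIV g x :> d"
  shows "gradient g x = d"
  unfolding gradient_def
proof (rule the_equality, rule assms)
  fix e
  assume "GDERIV g x :> e"
  then have "(\<lambda>h. h \<bullet> e) = (\<lambda>h. h \<bullet> d)"
    using assms unfolding gderiv_def by (rule has_derivative_unique)
  then have "\<forall>h. h \<bullet> e = h \<bullet> d"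
    by (simp add: fun_eq_iff)
  then show "e = d"
    by (simp only: vector_eq_ldot)
qed

text \<open>Riesz representation in finite dimension: the vector whose coordinates are the values of
  the derivative on the basis represents it, and by uniqueness it is the gradient.\<close>

lemma has_derivative_gradient:
  fixes g :: "'a::euclidean_space \<Rightarrow> real"
  assumes "g differentiable (at x)"
  shows "(g has_derivative (\<lambda>h. gradient g x \<bullet> h)) (at x)"
proof -
  let ?D = "frechet_derivative g (at x)"
  have D: "(g has_derivative ?D) (at x)"
    using assms frechet_derivative_works by blast
  then have lin: "linear ?D"
    by (rule has_derivative_linear)
  define d where "d = (\<Sum>b\<in>Basis. ?D b *\<^sub>R b)"
  have "?D h = h \<bullet> d" for h
  proof -
    have "?D h = ?D (\<Sum>b\<in>Basis. (h \<bullet> b) *\<^sub>R b)"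
      by (simp add: euclidean_representation)
    also have "\<dots> = h \<bullet> d"
      by (simp add: linear_sum[OF lin] linear_scale[OF lin] d_def inner_sum_right mult.commute)
    finally show ?thesis .
  qed
  then have "?D = (\<lambda>h. h \<bullet> d)"
    by auto
  with D have "GDERIV g x :> d"
    by (simp add: gderiv_def)
  with gradient_eq[OF this] show ?thesis
    by (simp add: gderiv_def inner_commute)
qed

lemma gradient_sum:
  fixes g :: "'i \<Rightarrow> 'a::euclidean_space \<Rightarrow> real"
  assumes "\<And>j. j \<in> J \<Longrightarrow> g j differentiable (at x)"
  shows "gradient (\<lambda>y. \<Sum>j\<in>J. g j y) x = (\<Sum>j\<in>J. gradient (g j) x)"
proof (rule gradient_eq)
  have "((\<lambda>y. \<Sum>j\<in>J. g j y) has_derivative (\<lambda>h. \<Sum>j\<in>J. gradient (g j) x \<bullet> h)) (at x)"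
    by (intro has_derivative_sum has_derivative_gradient assms)
  then show "GDERIV (\<lambda>y. \<Sum>j\<in>J. g j y) x :> (\<Sum>j\<in>J. gradient (g j) x)"
    by (simp add: gderiv_def inner_sum_right inner_commute)
qed

lemma has_real_derivative_along_line:
  fixes g :: "'a::euclidean_space \<Rightarrow> real"
  assumes "\<And>x. g differentiable (at x)"
  shows "((\<lambda>s. g (x + s *\<^sub>R t)) has_real_derivative gradient g (x + s *\<^sub>R t) \<bullet> t) (at s)"
proof -
  have "((\<lambda>s. x + s *\<^sub>R t) has_derivative (\<lambda>r. r *\<^sub>R t)) (at s)"
    by (auto intro!: derivative_eq_intros)
  from has_derivative_compose[OF this has_derivative_gradient[OF assms]] show ?thesis
    by (simp add: has_field_derivative_def mult_commute_abs)
qed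

text \<open>The descent lemma for a Lipschitz gradient, restricted to directions in one block. It is
  proved by monotonicity of a one-variable function instead of integration.\<close>

lemma block_descent:
  fixes g :: "real ^ 'k::finite \<Rightarrow> real"
  assumes diff: "\<And>x. g differentiable (at x)"
    and A: "block_spd blk i A"
    and Lip: "\<And>x t. t \<in> block_space blk i \<Longrightarrow>
        block_dual_norm blk i A (block_gradient blk i g (x + block_U blk i *v t) - block_gradient blk i g x)
          \<le> l * block_norm A t"
    and t: "t \<in> block_space blk i"
  shows "g (x + t) \<le> g x + gradient g x \<bullet> t + l / 2 * (block_norm A t)\<^sup>2"
proof -
  \<comment> \<open>\<open>\<phi>\<close> is \<open>g\<close> along the segment minus the linear
    term and the claimed quadratic bound, so \<open>\<phi> 1 \<le> \<phi> 0\<close> is the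
    goal.\<close>
  define \<phi> where "\<phi> s = g (x + s *\<^sub>R t) - s * (gradient g x \<bullet> t) - l / 2 * s\<^sup>2 * (block_norm A t)\<^sup>2" for s
  have "\<phi> 0 \<ge> \<phi> 1"
  proof (rule DERIV_nonpos_imp_nonincreasing[where f = \<phi>])
    fix s :: real
    assume s: "0 \<le> s" "s \<le> 1"
    let ?d = "block_gradient blk i g (x + s *\<^sub>R t) - block_gradient blk i g x"
    have d: "?d = block blk i (gradient g (x + s *\<^sub>R t) - gradient g x)"
      by (simp add: block_gradient_def block_U_mult_vec block_diff)
    have st: "s *\<^sub>R t \<in> block_space blk i"
      using t by (rule block_space_scaleR)
    \<comment> \<open>Since \<open>t\<close> lies in block \<open>i\<close>, the full gradient
      difference may be replaced by its block, for which the Lipschitz bound and norm duality are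
      available.\<close>
    have "(gradient g (x + s *\<^sub>R t) - gradient g x) \<bullet> t = ?d \<bullet> t"
      by (simp only: d inner_block block_eq_self[OF t])
    also have "\<dots> \<le> block_dual_norm blk i A ?d * block_norm A t"
      by (rule inner_le_block_dual_norm[OF A _ t]) (simp add: d)
    also have "\<dots> \<le> (l * block_norm A (s *\<^sub>R t)) * block_norm A t"
      using Lip[OF st, of x] block_spd_nonneg[OF A t]
      by (intro mult_right_mono) (simp_all add: block_U_mult_vec block_eq_self[OF st] block_norm_def)
    also have "\<dots> = l * s * (block_norm A t)\<^sup>2"
      using s by (simp add: block_norm_scaleR power2_eq_square)
    finally have "gradient g (x + s *\<^sub>R t) \<bullet> t - gradient g x \<bullet> t - l * s * (block_norm A t)\<^sup>2 \<le> 0"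
      by (simp add: inner_diff_left)
    moreover have "(\<phi> has_real_derivative
        gradient g (x + s *\<^sub>R t) \<bullet> t - gradient g x \<bullet> t - l * s * (block_norm A t)\<^sup>2) (at s)"
      unfolding \<phi>_def
      by (auto intro!: derivative_eq_intros has_real_derivative_along_line[OF diff])
    ultimately show "\<exists>y. (\<phi> has_real_derivative y) (at s) \<and> y \<le> 0"
      by blast
  qed simp
  then show ?thesis
    by (simp add: \<phi>_def)
qed

lemma gradient_inner_eq_0:
  fixes g :: "'a::euclidean_space \<Rightarrow> real"
  assumes "\<And>x. g differentiable (at x)" and "\<And>s. g (x + s *\<^sub>R t) = g x"
  shows "gradient g x \<bullet> t = 0"
proof -
  have "((\<lambda>s. g x) has_real_derivative gradient g (x + 0 *\<^sub>R t) \<bullet> t) (at 0)"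
    using has_real_derivative_along_line[OF assms(1), of x t 0] assms(2) by simp
  from DERIV_unique[OF this DERIV_const] show ?thesis
    by simp
qed

text \<open>Writing \<open>x + \<Sum>d i\<close> as the average of the points \<open>x + k d i\<close>, where \<open>k = card T\<close>.\<close>

lemma convex_sum_le:
  fixes g :: "'a::real_vector \<Rightarrow> real"
  assumes g: "convex_on UNIV g" and T: "finite T"
    and ub: "\<And>i s. i \<in> T \<Longrightarrow> g (x + s *\<^sub>R d i) \<le> g x + s * a i + s\<^sup>2 * b i"
  shows "g (x + (\<Sum>i\<in>T. d i)) \<le> g x + (\<Sum>i\<in>T. a i) + real (card T) * (\<Sum>i\<in>T. b i)"
proof (cases "T = {}")
  case False
  define k where "k = real (card T)"
  have k: "k > 0"
    using False T by (simp add: k_def card_gt_0_iff)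
  have avg: "x + (\<Sum>i\<in>T. d i) = (\<Sum>i\<in>T. (1 / k) *\<^sub>R (x + k *\<^sub>R d i))"
    using k by (simp add: scaleR_right_distrib sum.distrib sum_constant_scaleR k_def[symmetric])
  have "g (x + (\<Sum>i\<in>T. d i)) \<le> (\<Sum>i\<in>T. (1 / k) * g (x + k *\<^sub>R d i))"
    unfolding avg using k by (intro convex_on_sum[OF T False g]) (auto simp: k_def)
  \<comment> \<open>The bound is used at \<open>s = k\<close>. The weight \<open>1 / k\<close>
    cancels the stretching in the linear terms and leaves one factor \<open>k\<close> in the
    quadratic ones.\<close>
  also have "\<dots> \<le> (\<Sum>i\<in>T. (1 / k) * (g x + k * a i + k\<^sup>2 * b i))"
    using k by (intro sum_mono mult_left_mono ub) auto
  also have "\<dots> = (\<Sum>i\<in>T. (1 / k) * g x + a i + k * b i)"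
    using k by (intro sum.cong) (auto simp: field_simps power2_eq_square)
  also have "\<dots> = g x + (\<Sum>i\<in>T. a i) + k * (\<Sum>i\<in>T. b i)"
    using k by (simp add: sum.distrib sum_distrib_left k_def)
  finally show ?thesis
    by (simp add: k_def)
qed simp

text \<open>Blocks of \<open>S\<close> outside \<open>C\<close> are discarded through
  \<open>dep\<close> before convexity is applied; this is why the overlap
  \<open>card (S \<inter> C)\<close> appears and not \<open>card S\<close>.\<close>

lemma restrict_blocks_descent:
  fixes g :: "real ^ 'k::finite \<Rightarrow> real"
  assumes diff: "\<And>x. g differentiable (at x)"
    and conv: "convex_on UNIV g"
    and dep: "\<And>x y. (\<And>i. i \<in> C \<Longrightarrow> block blk i x = block blk i y) \<Longrightarrow> g x = g y"
    and A: "\<And>i. i \<in> C \<Longrightarrow> block_spd blk i (A i)"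
    and Lip: "\<And>i x t. i \<in> C \<Longrightarrow> t \<in> block_space blk i \<Longrightarrow>
        block_dual_norm blk i (A i)
            (block_gradient blk i g (x + block_U blk i *v t) - block_gradient blk i g x)
          \<le> l i * block_norm (A i) t"
    and S: "finite S"
  shows "g (x + restrict_blocks blk S h) \<le> g x + (\<Sum>i\<in>S \<inter> C. gradient g x \<bullet> block blk i h)
     + real (card (S \<inter> C)) * (\<Sum>i\<in>S \<inter> C. l i / 2 * (block_norm (A i) (block blk i h))\<^sup>2)"
proof -
  have "g (x + restrict_blocks blk S h) = g (x + restrict_blocks blk (S \<inter> C) h)"
    using S by (intro dep) (auto simp: vec_eq_iff block_nth restrict_blocks_nth)
  also have "\<dots> = g (x + (\<Sum>i\<in>S \<inter> C. block blk i h))"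
    by (simp add: restrict_blocks_eq_sum)
  also have "\<dots> \<le> g x + (\<Sum>i\<in>S \<inter> C. gradient g x \<bullet> block blk i h)
     + real (card (S \<inter> C)) * (\<Sum>i\<in>S \<inter> C. l i / 2 * (block_norm (A i) (block blk i h))\<^sup>2)"
  proof (rule convex_sum_le[OF conv])
    fix i s
    assume i: "i \<in> S \<inter> C"
    have "g (x + s *\<^sub>R block blk i h) \<le> g x + gradient g x \<bullet> (s *\<^sub>R block blk i h)
        + l i / 2 * (block_norm (A i) (s *\<^sub>R block blk i h))\<^sup>2"
      using i by (intro block_descent[OF diff A Lip] block_space_scaleR) auto
    \<comment> \<open>\<open>s\<close> ranges over all reals, also negative ones, so homogeneity is
      derived for the square of the norm, through the quadratic form.\<close>
    moreover have "(block_norm (A i) (s *\<^sub>R block blk i h))\<^sup>2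
        = s\<^sup>2 * (block_norm (A i) (block blk i h))\<^sup>2"
      using i block_norm_power2[OF A block_space_scaleR[OF block_in_block_space]]
        block_norm_power2[OF A block_in_block_space]
      by (simp add: matrix_vector_mult_scaleR power2_eq_square[of s])
    ultimately show "g (x + s *\<^sub>R block blk i h) \<le> g x + s * (gradient g x \<bullet> block blk i h)
        + s\<^sup>2 * (l i / 2 * (block_norm (A i) (block blk i h))\<^sup>2)"
      by (simp add: mult.left_commute)
  qed (use S in simp)
  finally show ?thesis .
qed

text \<open>Along a block outside \<open>C\<close> the function is constant, so its directional
  derivative there vanishes.\<close>

lemma gradient_inner_eq_sum_blocks:
  fixes g :: "real ^ 'k::finite \<Rightarrow> real"
  assumes blk: "\<And>k. blk k \<in> I" and I: "finite I" "C \<subseteq> I"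
    and diff: "\<And>x. g differentiable (at x)"
    and dep: "\<And>x y. (\<And>i. i \<in> C \<Longrightarrow> block blk i x = block blk i y) \<Longrightarrow> g x = g y"
  shows "gradient g x \<bullet> h = (\<Sum>i\<in>C. gradient g x \<bullet> block blk i h)"
proof -
  have "gradient g x \<bullet> h = (\<Sum>i\<in>I. gradient g x \<bullet> block blk i h)"
    by (simp add: restrict_blocks_all[OF blk I(1)] flip: inner_sum_right restrict_blocks_eq_sum)
  also have "\<dots> = (\<Sum>i\<in>C. gradient g x \<bullet> block blk i h)"
  proof (rule sum.mono_neutral_right[OF I], safe)
    fix i
    assume "i \<in> I" "i \<notin> C"
    then show "gradient g x \<bullet> block blk i h = 0"
      by (intro gradient_inner_eq_0[OF diff] dep) (auto simp: vec_eq_iff block_nth)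
  qed
  finally show ?thesis .
qed

section \<open>Nice samplings\<close>

text \<open>Removing \<open>T\<close> is a bijection onto the \<open>k\<close>-subsets of
  \<open>A - T\<close>. Writing the size as \<open>card T + k\<close> avoids truncated
  subtraction.\<close>

lemma card_subsets_containing:
  assumes "finite A" "T \<subseteq> A"
  shows "card {S. S \<subseteq> A \<and> card S = card T + k \<and> T \<subseteq> S} = card (A - T) choose k"
proof -
  have fin: "finite T"
    using assms finite_subset by blast
  have "bij_betw (\<lambda>S. S - T) {S. S \<subseteq> A \<and> card S = card T + k \<and> T \<subseteq> S} {R. R \<subseteq> A - T \<and> card R = k}"
  proof (rule bij_betw_byWitness[where f' = "\<lambda>R. R \<union> T"])
    show "(\<lambda>S. S - T) ` {S. S \<subseteq> A \<and> card S = card T + k \<and> T \<subseteq> S} \<subseteq> {R. R \<subseteq> A - T \<and> card R = k}"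
      using fin by (auto simp: card_Diff_subset)
    show "(\<lambda>R. R \<union> T) ` {R. R \<subseteq> A - T \<and> card R = k} \<subseteq> {S. S \<subseteq> A \<and> card S = card T + k \<and> T \<subseteq> S}"
    proof safe
      fix R
      assume R: "R \<subseteq> A - T"
      then have "finite R" "R \<inter> T = {}"
        using assms finite_subset by blast+
      then show "card (R \<union> T) = card T + card R"
        using fin by (simp add: card_Un_disjoint)
    qed (use assms in auto)
  qed auto
  then show ?thesis
    using assms n_subsets[of "A - T" k] by (simp add: bij_betw_same_card)
qed

text \<open>The random index set becomes a fixed one, so that expectations can be taken termwise and
  turn into probabilities.\<close>

lemma sum_Int_eq_indicator:
  fixes a :: "'i \<Rightarrow> real"
  assumes "finite C"
  shows "(\<Sum>i\<in>S \<inter> C. a i) = (\<Sum>i\<in>C. a i * indicator {S. i \<in> S} S)"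
  using assms by (simp add: Int_commute[of S] sum.inter_restrict indicator_def if_distrib cong: if_cong)

context
  fixes n \<tau> :: nat
  assumes \<tau>: "\<tau> \<in> {1..n}"
begin

text \<open>\<open>pmf_of_set\<close> is the uniform law only on a finite nonempty set. Nonemptiness
  comes from \<open>\<tau> \<le> n\<close>, which makes the binomial coefficient positive.\<close>

lemma nice_sampling_support:
  "finite {S. S \<subseteq> {1..n} \<and> card S = \<tau>}" "{S. S \<subseteq> {1..n} \<and> card S = \<tau>} \<noteq> {}"
  "card {S. S \<subseteq> {1..n} \<and> card S = \<tau>} = n choose \<tau>"
proof -
  show "finite {S. S \<subseteq> {1..n} \<and> card S = \<tau>}"
    by simp
  show card: "card {S. S \<subseteq> {1..n} \<and> card S = \<tau>} = n choose \<tau>"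
    using n_subsets[of "{1..n}" \<tau>] by simp
  with \<tau> have "card {S. S \<subseteq> {1..n} \<and> card S = \<tau>} > 0"
    by simp
  then show "{S. S \<subseteq> {1..n} \<and> card S = \<tau>} \<noteq> {}"
    by (metis card.empty less_irrefl)
qed

lemma finite_set_pmf_nice_sampling [simp]: "finite (set_pmf (nice_sampling n \<tau>))"
  unfolding nice_sampling_def set_pmf_of_set[OF nice_sampling_support(2,1)]
  by (rule nice_sampling_support)

lemma set_pmf_nice_samplingD: "S \<in> set_pmf (nice_sampling n \<tau>) \<Longrightarrow> S \<subseteq> {1..n}"
  unfolding nice_sampling_def set_pmf_of_set[OF nice_sampling_support(2,1)] by simp

lemma prob_nice_sampling_subset:
  assumes "T \<subseteq> {1..n}" "card T \<le> \<tau>"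
  shows "measure_pmf.prob (nice_sampling n \<tau>) {S. T \<subseteq> S}
    = real ((n - card T) choose (\<tau> - card T)) / real (n choose \<tau>)"
proof -
  have "{S. S \<subseteq> {1..n} \<and> card S = \<tau>} \<inter> {S. T \<subseteq> S}
      = {S. S \<subseteq> {1..n} \<and> card S = card T + (\<tau> - card T) \<and> T \<subseteq> S}"
    using assms by auto
  then have "card ({S. S \<subseteq> {1..n} \<and> card S = \<tau>} \<inter> {S. T \<subseteq> S}) = (n - card T) choose (\<tau> - card T)"
    using card_subsets_containing[OF _ assms(1), of "\<tau> - card T"] assms
    by (simp add: card_Diff_subset finite_subset)
  then show ?thesis
    unfolding nice_sampling_def measure_pmf_of_set[OF nice_sampling_support(2,1)]
    by (simp only: nice_sampling_support(3))
qed

text \<open>The quotient of binomials for \<open>T = {i}\<close> is simplified by the absorption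
  identity.\<close>

lemma prob_nice_sampling_mem:
  assumes "i \<in> {1..n}"
  shows "measure_pmf.prob (nice_sampling n \<tau>) {S. i \<in> S} = real \<tau> / real n"
proof -
  have "real \<tau> * real (n choose \<tau>) = real n * real ((n - 1) choose (\<tau> - 1))"
    using times_binomial_minus1_eq[of \<tau> n] \<tau> by (simp flip: of_nat_mult)
  moreover have "real (n choose \<tau>) > 0" "real n > 0"
    using \<tau> by auto
  moreover have "measure_pmf.prob (nice_sampling n \<tau>) {S. i \<in> S}
      = real ((n - 1) choose (\<tau> - 1)) / real (n choose \<tau>)"
    using prob_nice_sampling_subset[of "{i}"] assms \<tau> by simp
  ultimately show ?thesis
    by (simp add: frac_eq_eq mult.commute)
qed

text \<open>Absorption is applied twice. The case \<open>\<tau> = 1\<close> is separate: a singleton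
  contains no pair, and the factor \<open>real \<tau> - 1\<close> vanishes.\<close>

lemma prob_nice_sampling_mem_pair:
  assumes "i \<in> {1..n}" "l \<in> {1..n}" "i \<noteq> l"
  shows "measure_pmf.prob (nice_sampling n \<tau>) {S. i \<in> S \<and> l \<in> S}
    = real \<tau> / real n * ((real \<tau> - 1) / (real n - 1))"
proof (cases "\<tau> = 1")
  case True
  have "set_pmf (nice_sampling n \<tau>) \<inter> {S. i \<in> S \<and> l \<in> S} = {}"
    unfolding nice_sampling_def set_pmf_of_set[OF nice_sampling_support(2,1)]
    using True assms by (auto simp: card_1_singleton_iff)
  then show ?thesis
    using True by (simp add: measure_pmf_zero_iff)
next
  case False
  with \<tau> have n: "\<tau> \<ge> 2" "n \<ge> 2" "\<tau> \<le> n"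
    by auto
  have \<tau>_absorb: "real \<tau> * real (n choose \<tau>) = real n * real ((n - 1) choose (\<tau> - 1))"
    using times_binomial_minus1_eq[of \<tau> n] n by (simp flip: of_nat_mult)
  have "(\<tau> - 1) * ((n - 1) choose (\<tau> - 1)) = (n - 1) * ((n - 2) choose (\<tau> - 2))"
    using times_binomial_minus1_eq[of "\<tau> - 1" "n - 1"] n by (simp add: numeral_2_eq_2)
  moreover have n_diff: "real (\<tau> - 1) = real \<tau> - 1" "real (n - 1) = real n - 1"
    using n by auto
  ultimately have "(real \<tau> - 1) * real ((n - 1) choose (\<tau> - 1)) = (real n - 1) * real ((n - 2) choose (\<tau> - 2))"
    using n_diff by (metis of_nat_mult)
  with \<tau>_absorb have "real \<tau> * (real \<tau> - 1) * real (n choose \<tau>)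
      = real n * (real n - 1) * real ((n - 2) choose (\<tau> - 2))"
    by algebra
  then have "real ((n - 2) choose (\<tau> - 2)) * (real n * (real n - 1))
      = real \<tau> * (real \<tau> - 1) * real (n choose \<tau>)"
    by (simp only: mult_ac)
  moreover have "real (n choose \<tau>) \<noteq> 0" "real n * (real n - 1) \<noteq> 0"
    using n by auto
  moreover have "measure_pmf.prob (nice_sampling n \<tau>) {S. i \<in> S \<and> l \<in> S}
      = real ((n - 2) choose (\<tau> - 2)) / real (n choose \<tau>)"
    using prob_nice_sampling_subset[of "{i, l}"] assms n by (simp add: numeral_2_eq_2)
  ultimately show ?thesis
    by (simp only: times_divide_times_eq frac_eq_eq not_False_eq_True)
qed

section \<open>Expectations over a nice sampling\<close>

lemma expectation_nice_sampling_sum: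
  assumes "C \<subseteq> {1..n}"
  shows "measure_pmf.expectation (nice_sampling n \<tau>) (\<lambda>S. \<Sum>i\<in>S \<inter> C. a i)
    = real \<tau> / real n * (\<Sum>i\<in>C. a i)"
proof -
  have C: "finite C"
    using assms finite_subset by blast
  have "measure_pmf.expectation (nice_sampling n \<tau>) (\<lambda>S. \<Sum>i\<in>S \<inter> C. a i)
      = (\<Sum>i\<in>C. a i * measure_pmf.prob (nice_sampling n \<tau>) {S. i \<in> S})"
    by (simp add: sum_Int_eq_indicator[OF C] integrable_measure_pmf_finite)
  also have "\<dots> = real \<tau> / real n * (\<Sum>i\<in>C. a i)"
    unfolding sum_distrib_left using assms by (intro sum.cong) (auto simp: prob_nice_sampling_mem subset_iff)
  finally show ?thesis .
qed

text \<open>Expanding the cardinality as a sum of indicators gives a double sum of pair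
  probabilities. For each \<open>i\<close> the diagonal yields the \<open>1\<close> in the
  coefficient and the \<open>card C - 1\<close> other indices yield the rest.\<close>

lemma expectation_nice_sampling_card_sum:
  assumes "C \<subseteq> {1..n}"
  shows "measure_pmf.expectation (nice_sampling n \<tau>) (\<lambda>S. real (card (S \<inter> C)) * (\<Sum>i\<in>S \<inter> C. a i))
    = real \<tau> / real n *
      ((1 + (real (card C) - 1) * (real \<tau> - 1) / max 1 (real n - 1)) * (\<Sum>i\<in>C. a i))"
proof -
  define q where "q = (real \<tau> - 1) / max 1 (real n - 1)"
  have C: "finite C"
    using assms finite_subset by blast
  have "real (card (S \<inter> C)) * (\<Sum>i\<in>S \<inter> C. a i)
      = (\<Sum>i\<in>C. \<Sum>l\<in>C. a i * indicator {S. i \<in> S \<and> l \<in> S} S)" for S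
  proof -
    have "real (card (S \<inter> C)) = (\<Sum>l\<in>C. indicator {S. l \<in> S} S)"
      using sum_Int_eq_indicator[OF C, of "\<lambda>_. 1" S] by simp
    then have "real (card (S \<inter> C)) * (\<Sum>i\<in>S \<inter> C. a i)
        = (\<Sum>i\<in>C. a i * indicator {S. i \<in> S} S) * (\<Sum>l\<in>C. indicator {S. l \<in> S} S)"
      by (simp only: sum_Int_eq_indicator[OF C] mult.commute)
    also have "\<dots> = (\<Sum>i\<in>C. \<Sum>l\<in>C. a i * indicator {S. i \<in> S} S * indicator {S. l \<in> S} S)"
      by (rule sum_product)
    also have "\<dots> = (\<Sum>i\<in>C. \<Sum>l\<in>C. a i * indicator {S. i \<in> S \<and> l \<in> S} S)"
      by (intro sum.cong refl) (auto simp: indicator_def)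
    finally show ?thesis .
  qed
  then have "measure_pmf.expectation (nice_sampling n \<tau>) (\<lambda>S. real (card (S \<inter> C)) * (\<Sum>i\<in>S \<inter> C. a i))
      = (\<Sum>i\<in>C. \<Sum>l\<in>C. a i * measure_pmf.prob (nice_sampling n \<tau>) {S. i \<in> S \<and> l \<in> S})"
    by (simp add: integrable_measure_pmf_finite)
  also have "\<dots> = (\<Sum>i\<in>C. a i * (real \<tau> / real n * (1 + (real (card C) - 1) * q)))"
  proof (rule sum.cong[OF refl])
    fix i
    assume i: "i \<in> C"
    have pair: "measure_pmf.prob (nice_sampling n \<tau>) {S. i \<in> S \<and> l \<in> S} = real \<tau> / real n * q"
      if "l \<in> C - {i}" for l
    proof -
      have "i \<in> {1..n}" "l \<in> {1..n}" "i \<noteq> l"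
        using that i assms by auto
      \<comment> \<open>Two distinct blocks force \<open>n \<ge> 2\<close>, so the maximum only
        takes effect when there are no off-diagonal terms.\<close>
      moreover from this have "max 1 (real n - 1) = real n - 1"
        by auto
      ultimately show ?thesis
        by (simp add: prob_nice_sampling_mem_pair q_def)
    qed
    have "(\<Sum>l\<in>C. measure_pmf.prob (nice_sampling n \<tau>) {S. i \<in> S \<and> l \<in> S})
        = real \<tau> / real n + (\<Sum>l\<in>C - {i}. real \<tau> / real n * q)"
      using C i assms pair by (subst sum.remove[of _ i]) (auto simp: prob_nice_sampling_mem subset_iff)
    also have "\<dots> = real \<tau> / real n * (1 + (real (card C) - 1) * q)"
    proof -
      have "card C \<ge> 1"
        using C i by (metis card_gt_0_iff empty_iff One_nat_def Suc_leI)
      then show ?thesis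
        using C i by (simp add: card_Diff_singleton of_nat_diff algebra_simps diff_divide_distrib)
    qed
    finally show "(\<Sum>l\<in>C. a i * measure_pmf.prob (nice_sampling n \<tau>) {S. i \<in> S \<and> l \<in> S})
        = a i * (real \<tau> / real n * (1 + (real (card C) - 1) * q))"
      by (simp add: sum_distrib_left[symmetric])
  qed
  also have "\<dots> = (\<Sum>i\<in>C. a i) * (real \<tau> / real n * (1 + (real (card C) - 1) * q))"
    by (rule sum_distrib_right[symmetric])
  finally show ?thesis
    by (simp add: q_def mult_ac)
qed

text \<open>Claim (i) for a single summand: the pointwise bound is integrated. The sampling has
  finite support, which settles integrability.\<close>

lemma expectation_nice_sampling_le:
  fixes g :: "real ^ 'k::finite \<Rightarrow> real"
  assumes blk: "\<And>k. blk k \<in> {1..n}" and C: "C \<subseteq> {1..n}"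
    and diff: "\<And>x. g differentiable (at x)"
    and conv: "convex_on UNIV g"
    and dep: "\<And>x y. (\<And>i. i \<in> C \<Longrightarrow> block blk i x = block blk i y) \<Longrightarrow> g x = g y"
    and A: "\<And>i. i \<in> C \<Longrightarrow> block_spd blk i (A i)"
    and Lip: "\<And>i x t. i \<in> C \<Longrightarrow> t \<in> block_space blk i \<Longrightarrow>
        block_dual_norm blk i (A i)
            (block_gradient blk i g (x + block_U blk i *v t) - block_gradient blk i g x)
          \<le> l i * block_norm (A i) t"
  shows "measure_pmf.expectation (nice_sampling n \<tau>) (\<lambda>S. g (x + restrict_blocks blk S h))
    \<le> g x + real \<tau> / real n * (gradient g x \<bullet> h
        + (1 + (real (card C) - 1) * (real \<tau> - 1) / max 1 (real n - 1))
          * (\<Sum>i\<in>C. l i / 2 * (block_norm (A i) (block blk i h))\<^sup>2))"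
proof -
  define a b where "a i = gradient g x \<bullet> block blk i h"
    and "b i = l i / 2 * (block_norm (A i) (block blk i h))\<^sup>2" for i
  have "measure_pmf.expectation (nice_sampling n \<tau>) (\<lambda>S. g (x + restrict_blocks blk S h))
    \<le> measure_pmf.expectation (nice_sampling n \<tau>)
        (\<lambda>S. g x + (\<Sum>i\<in>S \<inter> C. a i) + real (card (S \<inter> C)) * (\<Sum>i\<in>S \<inter> C. b i))"
  proof (rule integral_mono_AE)
    \<comment> \<open>The bound is checked on the support only, where \<open>S\<close> is
      finite.\<close>
    show "AE S in nice_sampling n \<tau>. g (x + restrict_blocks blk S h)
        \<le> g x + (\<Sum>i\<in>S \<inter> C. a i) + real (card (S \<inter> C)) * (\<Sum>i\<in>S \<inter> C. b i)"
      unfolding AE_measure_pmf_iff a_def b_def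
      by (intro ballI restrict_blocks_descent[OF diff conv dep A Lip])
         (auto dest!: set_pmf_nice_samplingD intro: finite_subset)
  qed (simp_all add: integrable_measure_pmf_finite)
  also have "\<dots> = g x + real \<tau> / real n * (\<Sum>i\<in>C. a i) + real \<tau> / real n *
      ((1 + (real (card C) - 1) * (real \<tau> - 1) / max 1 (real n - 1)) * (\<Sum>i\<in>C. b i))"
    using expectation_nice_sampling_sum[OF C, of a] expectation_nice_sampling_card_sum[OF C, of b]
    by (simp add: integrable_measure_pmf_finite)
  also have "(\<Sum>i\<in>C. a i) = gradient g x \<bullet> h"
    unfolding a_def by (rule gradient_inner_eq_sum_blocks[OF blk _ C diff dep, symmetric]) auto
  finally show ?thesis
    by (simp add: b_def distrib_left)
qed

end

text \<open>Nonnegative weights are what allows the square root in \<open>weighted_norm\<close> to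
  be undone. For \<open>w = 0\<close>, a summand depending on no block, the claim amounts to
  \<open>q \<le> 1\<close>, which follows from \<open>\<tau> \<le> n\<close>.\<close>

lemma ESO_coefficient_nonneg:
  assumes "\<tau> \<in> {1..n}"
  shows "1 + (real w - 1) * (real \<tau> - 1) / max 1 (real n - 1) \<ge> 0"
proof -
  define q where "q = (real \<tau> - 1) / max 1 (real n - 1)"
  have q: "0 \<le> q" "q \<le> 1"
    using assms by (auto simp: q_def divide_le_eq)
  then have "real w * q \<ge> 0"
    by simp
  with q(2) have "1 + (real w - 1) * q \<ge> 0"
    by (simp add: algebra_simps)
  then show ?thesis
    by (simp add: q_def)
qed

section \<open>Weighted norms and the assembly of both bounds\<close>

lemma weighted_norm_power2:
  assumes "\<And>i. i \<in> {1..n} \<Longrightarrow> v i \<ge> 0"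
  shows "(weighted_norm blk n B v x)\<^sup>2 = (\<Sum>i=1..n. v i * (block_norm (B i) (block blk i x))\<^sup>2)"
  unfolding weighted_norm_def using assms by (intro real_sqrt_pow2 sum_nonneg mult_nonneg_nonneg) auto

theorem theorem1:
  fixes n m :: nat
    and blk :: "'k::finite \<Rightarrow> nat"
    and B :: "nat \<Rightarrow> real ^ 'k ^ 'k"
    and f :: "real ^ 'k \<Rightarrow> real"
    and fs :: "nat \<Rightarrow> real ^ 'k \<Rightarrow> real"
    and C :: "nat \<Rightarrow> nat set"
    and L :: "nat \<Rightarrow> nat \<Rightarrow> real"
  assumes blk: "\<And>k. blk k \<in> {1..n}"
    and B: "\<And>i. i \<in> {1..n} \<Longrightarrow> block_spd blk i (B i)"
    and f: "\<And>x. f x = (\<Sum>j=1..m. fs j x)"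
    and convex: "\<And>j. j \<in> {1..m} \<Longrightarrow> convex_on UNIV (fs j)"
    and differentiable: "\<And>j x. j \<in> {1..m} \<Longrightarrow> fs j differentiable (at x)"
    and C: "\<And>j. j \<in> {1..m} \<Longrightarrow> C j \<subseteq> {1..n}"
    and depends: "\<And>j x y. j \<in> {1..m} \<Longrightarrow> (\<And>i. i \<in> C j \<Longrightarrow> block blk i x = block blk i y) \<Longrightarrow>
                    fs j x = fs j y"
    and L_nonneg: "\<And>j i. j \<in> {1..m} \<Longrightarrow> i \<in> {1..n} \<Longrightarrow> L j i \<ge> 0"
    and L_zero: "\<And>j i. j \<in> {1..m} \<Longrightarrow> i \<in> {1..n} \<Longrightarrow> i \<notin> C j \<Longrightarrow> L j i = 0"
    and Lipschitz: "\<And>j i x t. j \<in> {1..m} \<Longrightarrow> i \<in> {1..n} \<Longrightarrow> t \<in> block_space blk i \<Longrightarrow>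
          block_dual_norm blk i (B i)
            (block_gradient blk i (fs j) (x + block_U blk i *v t) - block_gradient blk i (fs j) x)
          \<le> L j i * block_norm (B i) t"
  shows
    "(\<forall>\<tau>\<in>{1..n}.
        let \<beta> = (\<lambda>j. 1 + (real (card (C j)) - 1) * (real \<tau> - 1) / max 1 (real n - 1));
            v = (\<lambda>i. \<Sum>j=1..m. \<beta> j * L j i)
        in (\<forall>i\<in>{1..n}. v i = (\<Sum>j | j \<in> {1..m} \<and> i \<in> C j. \<beta> j * L j i)) \<and>
           (\<forall>x h. measure_pmf.expectation (nice_sampling n \<tau>) (\<lambda>S. f (x + restrict_blocks blk S h))
              \<le> f x + real \<tau> / real n *
                  (gradient f x \<bullet> h + 1 / 2 * (weighted_norm blk n B v h)\<^sup>2)))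
     \<and>
     ((\<Sum>j=1..m. \<Sum>i=1..n. L j i) > 0 \<longrightarrow>
       (let \<omega> = (\<lambda>j. real (card (C j)));
            Ltot = (\<Sum>j=1..m. \<Sum>i=1..n. L j i);
            \<omega>bar = (\<Sum>j=1..m. \<omega> j * ((\<Sum>i=1..n. L j i) / Ltot));
            Lbar = Ltot / real n;
            w = (\<lambda>i. real n / (\<Sum>j=1..m. \<Sum>l=1..n. \<omega> j * L j l) * (\<Sum>j=1..m. \<omega> j * L j i))
        in \<forall>x h. f (x + h) \<le> f x + gradient f x \<bullet> h
                    + \<omega>bar * Lbar / 2 * (weighted_norm blk n B w h)\<^sup>2))"
proof -
  define Q where "Q h i = (block_norm (B i) (block blk i h))\<^sup>2" for h i
  have f_eq: "f = (\<lambda>y. \<Sum>j=1..m. fs j y)"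
    using f by auto
  have grad_f: "gradient f x \<bullet> h = (\<Sum>j=1..m. gradient (fs j) x \<bullet> h)" for x h
    unfolding f_eq by (subst gradient_sum) (simp_all add: differentiable inner_sum_left)
  have sum_C: "(\<Sum>i\<in>C j. L j i / 2 * Q h i) = (\<Sum>i=1..n. L j i * Q h i) / 2" if "j \<in> {1..m}" for j h
    unfolding sum_divide_distrib
    using C[OF that] L_zero[OF that] by (intro sum.mono_neutral_cong_left) auto
  \<comment> \<open>Exchanging the sums over blocks and summands turns per-summand bounds into one
    weighted norm. The free coefficients \<open>\<gamma>\<close> serve \<open>v\<close> with
    \<open>\<beta>\<close> and \<open>w\<close> with the scaled cardinalities.\<close>
  have norm_eq: "(weighted_norm blk n B (\<lambda>i. \<Sum>j=1..m. \<gamma> j * L j i) h)\<^sup>2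
      = (\<Sum>j=1..m. \<gamma> j * (\<Sum>i=1..n. L j i * Q h i))"
    if "\<And>j. j \<in> {1..m} \<Longrightarrow> \<gamma> j \<ge> 0" for \<gamma> h
  proof -
    have "(weighted_norm blk n B (\<lambda>i. \<Sum>j=1..m. \<gamma> j * L j i) h)\<^sup>2
        = (\<Sum>i=1..n. \<Sum>j=1..m. \<gamma> j * (L j i * Q h i))"
      using that L_nonneg
      by (subst weighted_norm_power2)
         (auto intro!: sum_nonneg simp: Q_def sum_distrib_right mult.assoc)
    then show ?thesis
      by (subst (asm) sum.swap) (simp add: sum_distrib_left)
  qed
  have B_C: "block_spd blk i (B i)" if "j \<in> {1..m}" "i \<in> C j" for i j
    using B C that by blast
  have Lip_C: "block_dual_norm blk i (B i)
      (block_gradient blk i (fs j) (x + block_U blk i *v t) - block_gradient blk i (fs j) x)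
      \<le> L j i * block_norm (B i) t" if "j \<in> {1..m}" "i \<in> C j" "t \<in> block_space blk i" for i j x t
    using Lipschitz C that by blast

  have part1: "measure_pmf.expectation (nice_sampling n \<tau>) (\<lambda>S. f (x + restrict_blocks blk S h))
      \<le> f x + real \<tau> / real n * (gradient f x \<bullet> h + 1 / 2 *
          (weighted_norm blk n B (\<lambda>i. \<Sum>j=1..m. \<beta> j * L j i) h)\<^sup>2)"
    if \<tau>: "\<tau> \<in> {1..n}"
      and \<beta>: "\<beta> = (\<lambda>j. 1 + (real (card (C j)) - 1) * (real \<tau> - 1) / max 1 (real n - 1))"
    for \<tau> \<beta> x h
  proof -
    have \<beta>_nonneg: "\<beta> j \<ge> 0" for j
      unfolding \<beta> by (rule ESO_coefficient_nonneg[OF \<tau>])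
    have "measure_pmf.expectation (nice_sampling n \<tau>) (\<lambda>S. f (x + restrict_blocks blk S h))
        = (\<Sum>j=1..m. measure_pmf.expectation (nice_sampling n \<tau>)
            (\<lambda>S. fs j (x + restrict_blocks blk S h)))"
      unfolding f_eq
      by (intro Bochner_Integration.integral_sum integrable_measure_pmf_finite
          finite_set_pmf_nice_sampling \<tau>)
    also have "\<dots> \<le> (\<Sum>j=1..m. fs j x + real \<tau> / real n * (gradient (fs j) x \<bullet> h
        + \<beta> j * (\<Sum>i\<in>C j. L j i / 2 * Q h i)))"
      unfolding \<beta> Q_def
    proof (rule sum_mono, rule expectation_nice_sampling_le[OF \<tau> blk])
      fix j
      assume j: "j \<in> {1..m}"
      show "C j \<subseteq> {1..n}" "convex_on UNIV (fs j)" "fs j differentiable (at y)" for y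
        using j by (simp_all only: C convex differentiable)
      show "fs j y = fs j z" if "\<And>i. i \<in> C j \<Longrightarrow> block blk i y = block blk i z" for y z
        using j that by (rule depends)
    qed (use B_C Lip_C in simp_all)
    also have "\<dots> = (\<Sum>j=1..m. fs j x + real \<tau> / real n * (gradient (fs j) x \<bullet> h
        + 1 / 2 * (\<beta> j * (\<Sum>i=1..n. L j i * Q h i))))"
      by (intro sum.cong refl) (simp only: sum_C, simp)
    also have "\<dots> = f x + real \<tau> / real n * (gradient f x \<bullet> h + 1 / 2 *
          (weighted_norm blk n B (\<lambda>i. \<Sum>j=1..m. \<beta> j * L j i) h)\<^sup>2)"
      by (simp only: norm_eq[OF \<beta>_nonneg] grad_f f sum.distrib sum_distrib_left distrib_left)
    finally show ?thesis .
  qed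

  \<comment> \<open>Claim (ii) before normalisation: for the deterministic choice of all blocks the
    overlap with \<open>C j\<close> is all of \<open>C j\<close>, so its size replaces
    \<open>\<beta> j\<close>.\<close>
  have part2: "f (x + h) \<le> f x + gradient f x \<bullet> h
      + 1 / 2 * (\<Sum>j=1..m. real (card (C j)) * (\<Sum>i=1..n. L j i * Q h i))" for x h
  proof -
    have "fs j (x + h) \<le> fs j x + gradient (fs j) x \<bullet> h
        + 1 / 2 * (real (card (C j)) * (\<Sum>i=1..n. L j i * Q h i))" if j: "j \<in> {1..m}" for j
    proof -
      have "fs j (x + restrict_blocks blk {1..n} h)
        \<le> fs j x + (\<Sum>i\<in>{1..n} \<inter> C j. gradient (fs j) x \<bullet> block blk i h)
          + real (card ({1..n} \<inter> C j)) * (\<Sum>i\<in>{1..n} \<inter> C j. L j i / 2 * Q h i)"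
        unfolding Q_def
      proof (rule restrict_blocks_descent)
        show "fs j y = fs j z" if "\<And>i. i \<in> C j \<Longrightarrow> block blk i y = block blk i z" for y z
          using j that by (rule depends)
      qed (use j differentiable convex B_C Lip_C in simp_all)
      moreover have "{1..n} \<inter> C j = C j"
        using C[OF j] by auto
      moreover have "restrict_blocks blk {1..n} h = h"
        using blk by (intro restrict_blocks_all) auto
      moreover have "gradient (fs j) x \<bullet> h = (\<Sum>i\<in>C j. gradient (fs j) x \<bullet> block blk i h)"
      proof (rule gradient_inner_eq_sum_blocks[of blk "{1..n}"])
        show "fs j y = fs j z" if "\<And>i. i \<in> C j \<Longrightarrow> block blk i y = block blk i z" for y z
          using j that by (rule depends)
      qed (use blk C[OF j] differentiable[OF j] in simp_all)
      ultimately show ?thesis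
        by (simp only: sum_C[OF j])
    qed
    then have "(\<Sum>j=1..m. fs j (x + h)) \<le> (\<Sum>j=1..m. fs j x + gradient (fs j) x \<bullet> h
        + 1 / 2 * (real (card (C j)) * (\<Sum>i=1..n. L j i * Q h i)))"
      by (intro sum_mono)
    then show ?thesis
      by (simp only: f grad_f sum.distrib sum_distrib_left)
  qed

  \<comment> \<open>The normalisations cancel: the averaged degree is \<open>D / Ltot\<close>, so
    its product with \<open>Ltot / real n\<close> is \<open>D / real n\<close>, while the squared
    \<open>w\<close>-norm carries the factor \<open>real n / D\<close>.\<close>
  have part3: "(\<Sum>j=1..m. real (card (C j)) * ((\<Sum>i=1..n. L j i) / Ltot)) * (Ltot / real n) / 2 *
      (weighted_norm blk n B (\<lambda>i. real n / D * (\<Sum>j=1..m. real (card (C j)) * L j i)) h)\<^sup>2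
      = 1 / 2 * (\<Sum>j=1..m. real (card (C j)) * (\<Sum>i=1..n. L j i * Q h i))"
    if Ltot: "Ltot = (\<Sum>j=1..m. \<Sum>i=1..n. L j i)" "Ltot > 0"
      and D: "D = (\<Sum>j=1..m. \<Sum>l=1..n. real (card (C j)) * L j l)" for Ltot D h
  proof -
    \<comment> \<open>The coordinate type is inhabited, so at least one block number exists.\<close>
    have "n > 0"
      using blk by (metis atLeastAtMost_iff le_trans not_gr_zero not_one_le_zero)
    \<comment> \<open>Positivity of \<open>D\<close> is inherited from \<open>Ltot\<close>: a
      nonzero \<open>L j i\<close> forces \<open>i \<in> C j\<close>, hence a cardinality of at
      least one.\<close>
    have "Ltot \<le> D"
      unfolding Ltot D
    proof (intro sum_mono)
      fix j i
      assume ji: "j \<in> {1..m}" "i \<in> {1..n}"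
      show "L j i \<le> real (card (C j)) * L j i"
      proof (cases "i \<in> C j")
        case True
        then have "card (C j) \<ge> 1"
          using C[OF ji(1)] by (metis card_gt_0_iff empty_iff finite_atLeastAtMost finite_subset
              One_nat_def Suc_leI)
        then have "1 * L j i \<le> real (card (C j)) * L j i"
          using L_nonneg[OF ji] by (intro mult_right_mono) auto
        then show ?thesis by simp
      qed (simp add: L_zero[OF ji])
    qed
    then have "D > 0"
      using Ltot(2) by simp
    define P where "P = (\<Sum>j=1..m. real (card (C j)) * (\<Sum>i=1..n. L j i * Q h i))"
    have \<omega>bar: "(\<Sum>j=1..m. real (card (C j)) * ((\<Sum>i=1..n. L j i) / Ltot)) = D / Ltot"
      by (simp add: D sum_divide_distrib sum_distrib_left)
    have w_norm: "(weighted_norm blk n B (\<lambda>i. real n / D * (\<Sum>j=1..m. real (card (C j)) * L j i)) h)\<^sup>2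
        = real n / D * P"
    proof -
      have "(\<lambda>i. real n / D * (\<Sum>j=1..m. real (card (C j)) * L j i))
          = (\<lambda>i. \<Sum>j=1..m. (real n / D * real (card (C j))) * L j i)"
        by (simp add: sum_distrib_left mult.assoc)
      moreover have "(\<Sum>j=1..m. (real n / D * real (card (C j))) * (\<Sum>i=1..n. L j i * Q h i))
          = real n / D * P"
        unfolding P_def by (simp only: sum_distrib_left mult.assoc)
      ultimately show ?thesis
        using \<open>D > 0\<close> by (simp only:) (subst norm_eq, simp_all)
    qed
    show ?thesis
      unfolding \<omega>bar w_norm P_def[symmetric]
      using \<open>D > 0\<close> \<open>n > 0\<close> \<open>Ltot > 0\<close> by (simp add: field_simps)
  qed

  have v_eq: "(\<Sum>j=1..m. \<gamma> j * L j i) = (\<Sum>j | j \<in> {1..m} \<and> i \<in> C j. \<gamma> j * L j i)"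
    if "i \<in> {1..n}" for \<gamma> i
    using L_zero that by (intro sum.mono_neutral_right) auto

  show ?thesis
    unfolding Let_def
  proof (intro conjI ballI allI impI)
    fix \<tau> i
    assume "i \<in> {1..n}"
    then show "(\<Sum>j=1..m. (1 + (real (card (C j)) - 1) * (real \<tau> - 1) / max 1 (real n - 1)) * L j i)
        = (\<Sum>j | j \<in> {1..m} \<and> i \<in> C j.
            (1 + (real (card (C j)) - 1) * (real \<tau> - 1) / max 1 (real n - 1)) * L j i)"
      by (rule v_eq)
  next
    fix \<tau> x h
    assume "\<tau> \<in> {1..n}"
    then show "measure_pmf.expectation (nice_sampling n \<tau>) (\<lambda>S. f (x + restrict_blocks blk S h))
        \<le> f x + real \<tau> / real n * (gradient f x \<bullet> h + 1 / 2 * (weighted_norm blk n B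
          (\<lambda>i. \<Sum>j=1..m. (1 + (real (card (C j)) - 1) * (real \<tau> - 1) / max 1 (real n - 1)) * L j i) h)\<^sup>2)"
      by (rule part1) (rule refl)
  next
    fix x h
    assume pos: "(\<Sum>j=1..m. \<Sum>i=1..n. L j i) > 0"
    show "f (x + h) \<le> f x + gradient f x \<bullet> h +
        (\<Sum>j=1..m. real (card (C j)) * ((\<Sum>i=1..n. L j i) / (\<Sum>j=1..m. \<Sum>i=1..n. L j i))) *
        ((\<Sum>j=1..m. \<Sum>i=1..n. L j i) / real n) / 2 *
        (weighted_norm blk n B (\<lambda>i. real n / (\<Sum>j=1..m. \<Sum>l=1..n. real (card (C j)) * L j l) *
          (\<Sum>j=1..m. real (card (C j)) * L j i)) h)\<^sup>2"
      by (subst part3[OF refl pos refl]) (rule part2)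
  qed
qed

end
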